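(* Let $N\geq 2$. There exists a constant $K>0$, independent of $\lambda$ and $u$, such that for all $u\in C_{0}^{\infty}(\mathbb{H}^{N})$ and all $\lambda>0$, $$\frac{\lambda^{2}}{2}\int_{\mathbb{H}^{N}}|\nabla_{\mathbb{H}}u|^{2}e^{-\frac{\rho^{2}(x)}{\lambda^{2}}}dV_{\mathbb{H}}\geq K\inf_{c\in\mathbb{R}}\int_{\mathbb{H}^{N}}|u-c|^{2}\left(1-\tanh^{2}\left(\frac{\rho(x)}{2}\right)\right)^{N}e^{-\frac{\rho^{2}(x)}{\lambda^{2}}}dV_{\mathbb{H}}.$$
   Context: $\mathbb{H}^{N}$ is the hyperbolic space in the Poincaré ball model: the Euclidean unit ball with Riemannian metric $\left(\frac{2}{1-|x|^{2}}\right)^{2}dx^{2}$, volume element $dV_{\mathbb{H}}=\left(\frac{2}{1-|x|^{2}}\right)^{N}dx$, Riemannian gradient $\nabla_{\mathbb{H}}=\left(\frac{1-|x|^{2}}{2}\right)^{2}\nabla$; $|\nabla_{\mathbb H}u|$ is the Riemannian norm. $\rho(x)=\log\frac{1+|x|}{1-|x|}$ is the hyperbolic distance from $x$ to $0$. Functions are real-valued; $C_0^\infty$ means smooth with compact support. *)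

theory Defs
  imports "HOL-Analysis.Analysis"
begin

text \<open>
  The Poincare ball model of dimension \<open>N = DIM('a)\<close> is carried by \<open>ball 0 1\<close> in an
  \<open>N\<close>-dimensional Euclidean space \<open>'a\<close>.  Tangent vectors are elements of \<open>'a\<close>, and functions
  on the ball are total functions on \<open>'a\<close> whose values outside the ball are never used.
\<close>

definition hyp_inner :: "'a::euclidean_space \<Rightarrow> 'a \<Rightarrow> 'a \<Rightarrow> real"
  where "hyp_inner x v w = (2 / (1 - (norm x)\<^sup>2))\<^sup>2 * (v \<bullet> w)"

definition hyp_norm :: "'a::euclidean_space \<Rightarrow> 'a \<Rightarrow> real"
  where "hyp_norm x v = sqrt (hyp_inner x v v)"

definition hyp_volume :: "'a::euclidean_space measure"
  where "hyp_volume =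
    density (restrict_space lborel (ball 0 1))
      (\<lambda>x. ennreal ((2 / (1 - (norm x)\<^sup>2)) ^ DIM('a)))"

definition gradient :: "('a::euclidean_space \<Rightarrow> real) \<Rightarrow> 'a \<Rightarrow> 'a"
  where "gradient u x = (THE D. GDERIV u x :> D)"

definition hyp_gradient :: "('a::euclidean_space \<Rightarrow> real) \<Rightarrow> 'a \<Rightarrow> 'a"
  where "hyp_gradient u x = ((1 - (norm x)\<^sup>2) / 2)\<^sup>2 *\<^sub>R gradient u x"

definition hyp_rho :: "'a::euclidean_space \<Rightarrow> real"
  where "hyp_rho x = ln ((1 + norm x) / (1 - norm x))"

text \<open>
  \<open>times_diff_on k S f\<close> expresses, for open \<open>S\<close>, that \<open>f\<close> is of class \<open>C\<^sup>k\<close> on \<open>S\<close>: all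
  iterated directional derivatives up to order \<open>k\<close> exist and are continuous.
\<close>

primrec times_diff_on :: "nat \<Rightarrow> 'a::euclidean_space set \<Rightarrow> ('a \<Rightarrow> real) \<Rightarrow> bool"
  where
    "times_diff_on 0 S f \<longleftrightarrow> continuous_on S f"
  | "times_diff_on (Suc k) S f \<longleftrightarrow>
       (\<forall>x\<in>S. f differentiable (at x)) \<and>
       (\<forall>v. times_diff_on k S (\<lambda>x. frechet_derivative f (at x) v))"

definition smooth_on :: "'a::euclidean_space set \<Rightarrow> ('a \<Rightarrow> real) \<Rightarrow> bool"
  where "smooth_on S f \<longleftrightarrow> (\<forall>k. times_diff_on k S f)"

text \<open>
  The closure below is taken in \<open>'a\<close>; requiring it to lie inside the open ball makes it the
  closed support in the ball, and a compact one, since it is closed and bounded.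
\<close>

definition test_functions :: "('a::euclidean_space \<Rightarrow> real) set"
  where "test_functions =
    {u. smooth_on (ball 0 1) u \<and>
        compact (closure (support_on (ball 0 1) u)) \<and>
        closure (support_on (ball 0 1) u) \<subseteq> ball 0 1}"

end

theory Submission
  imports Defs
begin

text \<open>
  Since \<open>tanh (\<rho>/2) = |x|\<close>, the right-hand side is \<open>2\<^sup>N\<close> times the infimum over \<open>c\<close> of
  the Euclidean integrals of \<open>|u - c|\<^sup>2 exp (- \<phi>)\<close>, where \<open>\<phi> = \<rho>\<^sup>2/\<lambda>\<^sup>2\<close> is convex with
  \<open>\<phi> \<ge> 4|x|\<^sup>2/\<lambda>\<^sup>2\<close>; as \<open>N \<ge> 2\<close>, the left-hand side dominates the Euclidean energy with
  the same weight.  For the resulting weighted Poincare inequality take \<open>c = u y\<close> and average over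
  \<open>y\<close>.  Passing through the midpoint of \<open>x\<close> and \<open>y\<close>, by symmetry it suffices to
  bound \<open>|u x - u m|\<^sup>2\<close> along the segment from \<open>x\<close> to the midpoint \<open>m\<close>.  Convexity of \<open>\<phi>\<close> gives
  \<open>exp (- \<phi> x - \<phi> y) \<le> exp (- \<phi> z) exp (- t \<phi> x) exp (- \<phi> y/2)\<close> at \<open>z = (1 - t) x + t y\<close>
  with \<open>t \<le> 1/2\<close>; the last two factors absorb \<open>t |x - y|\<^sup>2\<close> at the cost of a multiple of
  \<open>\<lambda>\<^sup>2\<close>, leaving \<open>exp (- \<phi> y/4)\<close>, and \<open>x \<mapsto> z\<close> is a change of variables with Jacobian at least \<open>2\<^sup>-\<^sup>N\<close>.
\<close>

subsection \<open>A Poincare inequality for log-concave weights\<close>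

text \<open>The exact factor is the power \<open>DIM('a)\<close> of \<open>1 / c\<close>;
  \<open>b\<close> is any convenient upper bound for \<open>1 / c\<close>, so that a whole range of
  dilations shares one constant.\<close>

lemma nn_integral_dilation_le:
  fixes H :: "'a::euclidean_space \<Rightarrow> ennreal"
  assumes [measurable]: "H \<in> borel_measurable borel" and c: "0 < c" and bc: "1 \<le> b * c"
  shows "(\<integral>\<^sup>+x. H (t + c *\<^sub>R x) \<partial>lborel) \<le> ennreal (b ^ DIM('a)) * (\<integral>\<^sup>+x. H x \<partial>lborel)"
proof -
  have b: "0 \<le> b" using c bc by (metis less_eq_real_def linorder_not_less mult_nonpos_nonneg not_one_le_zero order_trans)
  let ?J = "\<integral>\<^sup>+x. H (t + c *\<^sub>R x) \<partial>lborel"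
  have "(\<integral>\<^sup>+x. H x \<partial>lborel) = ennreal (c ^ DIM('a)) * ?J"
    using c by (subst lborel_affine[of c t])
      (simp_all add: nn_integral_density nn_integral_distr nn_integral_cmult ennreal_power)
  then have "ennreal (b ^ DIM('a)) * (\<integral>\<^sup>+x. H x \<partial>lborel) = ennreal ((b * c) ^ DIM('a)) * ?J"
    using b c by (simp add: power_mult_distrib ennreal_mult mult_ac)
  moreover have "1 * ?J \<le> ennreal ((b * c) ^ DIM('a)) * ?J"
    using bc by (intro mult_right_mono) (auto simp: one_le_power)
  ultimately show ?thesis by simp
qed

text \<open>Cauchy-Schwarz on the unit interval, from expanding the nonnegative integral of
  \<open>(f' s - m)\<^sup>2\<close> with \<open>m\<close> the mean of \<open>f'\<close>. The factor
  \<open>k\<close> later carries the weight of a pair of points.\<close>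

lemma square_integral_le:
  fixes f f' :: "real \<Rightarrow> real"
  assumes f: "\<And>s. s \<in> {0..1} \<Longrightarrow> (f has_vector_derivative f' s) (at s within {0..1})"
    and cont: "continuous_on {0..1} f'" and k: "0 \<le> k"
  shows "ennreal (k * (f 1 - f 0)\<^sup>2) \<le> (\<integral>\<^sup>+s\<in>{0..1}. ennreal (k * (f' s)\<^sup>2) \<partial>lborel)"
proof -
  define m where "m = f 1 - f 0"
  have 1: "(f' has_integral m) {0..1}"
    unfolding m_def by (rule fundamental_theorem_of_calculus) (use f in auto)
  obtain J where J: "((\<lambda>s. (f' s)\<^sup>2) has_integral J) {0..1}"
    using integrable_continuous_real[OF continuous_on_power[OF cont, of 2]] by (auto simp: integrable_on_def)
  have "((\<lambda>s. (f' s)\<^sup>2 - 2 * m * f' s + m\<^sup>2) has_integral J - 2 * m * m + m\<^sup>2) {0..1}"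
    using has_integral_const_real[of "m\<^sup>2" 0 1]
    by (intro has_integral_add has_integral_diff J has_integral_mult_right 1) auto
  moreover have "(f' s)\<^sup>2 - 2 * m * f' s + m\<^sup>2 = (f' s - m)\<^sup>2" for s
    by (simp add: power2_diff)
  ultimately have "((\<lambda>s. (f' s - m)\<^sup>2) has_integral J - 2 * m * m + m\<^sup>2) {0..1}" by simp
  then have "0 \<le> J - 2 * m * m + m\<^sup>2" by (rule has_integral_nonneg) simp
  then have "m\<^sup>2 \<le> J" by (simp add: power2_eq_square)
  then show ?thesis
    using nn_integral_has_integral_lebesgue'[OF _ has_integral_mult_right[OF J, of k]] k
    by (simp add: m_def ennreal_leI mult_left_mono)
qed

text \<open>
  The quadratic parametrisation turns Cauchy-Schwarz into a bound with the factor \<open>s\<^sup>2 = 2 t\<close>, without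
  which the integral over \<open>t\<close> of the weight estimate would diverge logarithmically at \<open>0\<close>.
\<close>
lemma midpoint_square_le:
  fixes u :: "'a::euclidean_space \<Rightarrow> real"
  assumes S: "convex S"
    and u: "\<And>x. x \<in> S \<Longrightarrow> GDERIV u x :> D x"
    and D: "continuous_on S D"
    and xy: "x \<in> S" "y \<in> S" and k: "0 \<le> k"
  shows "ennreal (k * (u x - u ((1/2) *\<^sub>R (x + y)))\<^sup>2)
    \<le> (\<integral>\<^sup>+s\<in>{0..1}. ennreal (k * (s\<^sup>2 * (norm (D ((1 - s\<^sup>2/2) *\<^sub>R x + (s\<^sup>2/2) *\<^sub>R y)))\<^sup>2 * (norm (x - y))\<^sup>2)) \<partial>lborel)"
proof -
  \<comment> \<open>As \<open>s\<^sup>2/2\<close> runs from 0 to 1/2, \<open>z\<close> goes from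
    \<open>x\<close> at \<open>s = 0\<close> to the midpoint at \<open>s = 1\<close>; its velocity
    \<open>s *\<^sub>R (y - x)\<close> supplies the factor \<open>s\<^sup>2\<close> after
    squaring.\<close>
  define z where "z = (\<lambda>s::real. (1 - s\<^sup>2/2) *\<^sub>R x + (s\<^sup>2/2) *\<^sub>R y)"
  have zS: "z s \<in> S" if "s \<in> {0..1}" for s
    unfolding z_def using that xy power_le_one[of s 2] by (intro convexD_alt[OF S]) auto
  have dz: "(z has_vector_derivative s *\<^sub>R (y - x)) (at s within {0..1})" for s
    unfolding z_def by (auto intro!: derivative_eq_intros simp: algebra_simps)
  have "((\<lambda>s. u (z s)) has_vector_derivative (s *\<^sub>R (y - x)) \<bullet> D (z s)) (at s within {0..1})"
    if "s \<in> {0..1}" for s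
    using vector_derivative_diff_chain_within[OF dz, of u "\<lambda>h. h \<bullet> D (z s)"] u[OF zS[OF that]]
    by (auto simp: o_def gderiv_def intro: has_derivative_at_withinI)
  moreover have "continuous_on {0..1} (\<lambda>s. (s *\<^sub>R (y - x)) \<bullet> D (z s))"
    by (intro continuous_intros continuous_on_compose2[OF D])
       (auto simp: zS, auto simp: z_def intro!: continuous_intros)
  ultimately have "ennreal (k * (u (z 1) - u (z 0))\<^sup>2)
      \<le> (\<integral>\<^sup>+s\<in>{0..1}. ennreal (k * ((s *\<^sub>R (y - x)) \<bullet> D (z s))\<^sup>2) \<partial>lborel)"
    using k by (rule square_integral_le)
  also have "\<dots> \<le> (\<integral>\<^sup>+s\<in>{0..1}. ennreal (k * (s\<^sup>2 * (norm (D (z s)))\<^sup>2 * (norm (x - y))\<^sup>2)) \<partial>lborel)"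
  proof (intro nn_integral_mono mult_right_mono ennreal_leI mult_left_mono k)
    fix s :: real
    have "((s *\<^sub>R (y - x)) \<bullet> D (z s))\<^sup>2 \<le> (norm (s *\<^sub>R (y - x)) * norm (D (z s)))\<^sup>2"
      by (metis Cauchy_Schwarz_ineq2 abs_le_square_iff abs_norm_cancel norm_mult real_norm_def)
    then show "((s *\<^sub>R (y - x)) \<bullet> D (z s))\<^sup>2 \<le> s\<^sup>2 * (norm (D (z s)))\<^sup>2 * (norm (x - y))\<^sup>2"
      by (simp add: power_mult_distrib norm_minus_commute mult_ac)
  qed simp
  finally show ?thesis
    by (simp add: z_def power2_commute scaleR_add_right)
qed

section \<open>Pointwise decay estimate for pairs of weights\<close>

lemma mult_exp_neg_le_one: "r * exp (- r) \<le> (1::real)"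
proof -
  have "r \<le> exp r" using exp_ge_add_one_self[of r] by linarith
  then have "r * exp (- r) \<le> exp r * exp (- r)" by (intro mult_right_mono) auto
  then show ?thesis by (simp add: exp_minus_inverse)
qed

text \<open>Used with \<open>t = s\<^sup>2/2\<close>. Once \<open>\<phi>\<close> at the intermediate
  point is split off, only \<open>t * \<phi> x\<close> of the decay in \<open>x\<close> is left,
  which can absorb \<open>t * (norm x)\<^sup>2\<close> but not \<open>(norm x)\<^sup>2\<close>
  uniformly in \<open>t\<close>. Bounding \<open>(norm (x - y))\<^sup>2\<close> by twice the sum of
  the squared norms leaves \<open>4 * (1/a) + 4 * (2/a) = 12/a\<close>.\<close>

lemma log_concave_weight_le:
  fixes \<phi> :: "'a::euclidean_space \<Rightarrow> real"
  assumes \<phi>: "convex_on S \<phi>" and a: "0 < a" "\<And>x. x \<in> S \<Longrightarrow> a * (norm x)\<^sup>2 \<le> \<phi> x"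
    and xy: "x \<in> S" "y \<in> S" and t: "0 \<le> t" "t \<le> 1/2"
  shows "2 * t * (norm (x - y))\<^sup>2 * exp (- \<phi> x) * exp (- \<phi> y)
    \<le> 12 / a * exp (- \<phi> ((1 - t) *\<^sub>R x + t *\<^sub>R y)) * exp (- \<phi> y / 4)"
proof -
  let ?z = "(1 - t) *\<^sub>R x + t *\<^sub>R y"
  have nonneg: "0 \<le> \<phi> x" "0 \<le> \<phi> y"
    using a(2)[OF xy(1)] a(2)[OF xy(2)] a(1) by (smt (verit) mult_nonneg_nonneg zero_le_power2)+
  have "\<phi> ?z \<le> (1 - t) * \<phi> x + t * \<phi> y"
    using t xy by (intro convex_onD[OF \<phi>]) auto
  \<comment> \<open>Since \<open>1 - t\<close> is at least 1/2, half of \<open>\<phi> y\<close>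
    survives convexity: one quarter absorbs \<open>(norm y)\<^sup>2\<close>, the other stays as the
    weight for the integration over \<open>y\<close>.\<close>
  moreover have "t * \<phi> y \<le> 1/2 * \<phi> y" using t nonneg by (intro mult_right_mono) auto
  ultimately have "- \<phi> x - \<phi> y \<le> - \<phi> ?z + (- (t * \<phi> x) - \<phi> y / 4) + - \<phi> y / 4"
    by (simp add: algebra_simps)
  then have 1: "exp (- \<phi> x) * exp (- \<phi> y) \<le> exp (- \<phi> ?z) * exp (- (t * \<phi> x) - \<phi> y / 4) * exp (- \<phi> y / 4)"
    by (simp flip: exp_add)
  have X: "t * (norm x)\<^sup>2 * exp (- (t * \<phi> x) - \<phi> y / 4) \<le> 1 / a"
  proof -
    have "t * (norm x)\<^sup>2 * exp (- (t * \<phi> x) - \<phi> y / 4) \<le> t * (norm x)\<^sup>2 * exp (- (a * (t * (norm x)\<^sup>2)))"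
      using a(2)[OF xy(1)] t nonneg mult_left_mono[OF a(2)[OF xy(1)] t(1)]
      by (intro mult_left_mono) (auto simp: mult_ac)
    also have "a * \<dots> \<le> 1" using mult_exp_neg_le_one[of "a * (t * (norm x)\<^sup>2)"] by (simp add: mult_ac)
    then have "t * (norm x)\<^sup>2 * exp (- (a * (t * (norm x)\<^sup>2))) \<le> 1 / a" using a(1) by (simp add: field_simps)
    finally show ?thesis .
  qed
  have Y: "t * (norm y)\<^sup>2 * exp (- (t * \<phi> x) - \<phi> y / 4) \<le> 2 / a"
  proof -
    have "t * (norm y)\<^sup>2 * exp (- (t * \<phi> x) - \<phi> y / 4) \<le> 1/2 * (norm y)\<^sup>2 * exp (- (a / 4 * (norm y)\<^sup>2))"
      using a(2)[OF xy(2)] t mult_nonneg_nonneg[OF t(1) nonneg(1)] by (intro mult_mono) auto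
    also have "a / 2 * \<dots> \<le> 1" using mult_exp_neg_le_one[of "a / 4 * (norm y)\<^sup>2"] by (simp add: mult_ac)
    then have "1/2 * (norm y)\<^sup>2 * exp (- (a / 4 * (norm y)\<^sup>2)) \<le> 2 / a" using a(1) by (simp add: field_simps)
    finally show ?thesis .
  qed
  have "(norm (x - y))\<^sup>2 \<le> 2 * (norm x)\<^sup>2 + 2 * (norm y)\<^sup>2"
  proof -
    have "(norm (x - y))\<^sup>2 \<le> (norm x + norm y)\<^sup>2"
      by (intro power_mono norm_triangle_ineq4) simp
    also have "\<dots> \<le> 2 * (norm x)\<^sup>2 + 2 * (norm y)\<^sup>2"
      using zero_le_power2[of "norm x - norm y"] by (simp add: power2_sum power2_diff)
    finally show ?thesis .
  qed
  then have "2 * t * (norm (x - y))\<^sup>2 \<le> 2 * t * (2 * (norm x)\<^sup>2 + 2 * (norm y)\<^sup>2)"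
    using t by (intro mult_left_mono) auto
  then have "2 * t * (norm (x - y))\<^sup>2 * exp (- (t * \<phi> x) - \<phi> y / 4)
      \<le> 2 * t * (2 * (norm x)\<^sup>2 + 2 * (norm y)\<^sup>2) * exp (- (t * \<phi> x) - \<phi> y / 4)"
    by (rule mult_right_mono) simp
  also have "\<dots> = 4 * (t * (norm x)\<^sup>2 * exp (- (t * \<phi> x) - \<phi> y / 4)) + 4 * (t * (norm y)\<^sup>2 * exp (- (t * \<phi> x) - \<phi> y / 4))"
    by (simp add: algebra_simps)
  also have "\<dots> \<le> 12 / a" using X Y by (simp add: field_simps)
  finally have 2: "2 * t * (norm (x - y))\<^sup>2 * exp (- (t * \<phi> x) - \<phi> y / 4) \<le> 12 / a" .
  have "2 * t * (norm (x - y))\<^sup>2 * (exp (- \<phi> x) * exp (- \<phi> y))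
      \<le> 2 * t * (norm (x - y))\<^sup>2 * (exp (- \<phi> ?z) * exp (- (t * \<phi> x) - \<phi> y / 4) * exp (- \<phi> y / 4))"
    using t by (intro mult_left_mono 1) auto
  also have "\<dots> = (2 * t * (norm (x - y))\<^sup>2 * exp (- (t * \<phi> x) - \<phi> y / 4)) * (exp (- \<phi> ?z) * exp (- \<phi> y / 4))"
    by (simp add: mult_ac)
  also have "\<dots> \<le> 12 / a * (exp (- \<phi> ?z) * exp (- \<phi> y / 4))"
    by (intro mult_right_mono 2) auto
  finally show ?thesis by (simp add: mult_ac)
qed

section \<open>Averaging over pairs of points\<close>

lemma weighted_poincare_midpoint:
  fixes u \<phi> :: "'a::euclidean_space \<Rightarrow> real"
  assumes S: "open S" "convex S"
    and \<phi>: "convex_on S \<phi>" and a: "0 < a" "\<And>x. x \<in> S \<Longrightarrow> a * (norm x)\<^sup>2 \<le> \<phi> x"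
    and u: "\<And>x. x \<in> S \<Longrightarrow> GDERIV u x :> D x"
    and D: "continuous_on S D"
  shows "(\<integral>\<^sup>+y\<in>S. (\<integral>\<^sup>+x\<in>S. ennreal ((u x - u ((1/2) *\<^sub>R (x + y)))\<^sup>2 * exp (- \<phi> x) * exp (- \<phi> y)) \<partial>lborel) \<partial>lborel)
    \<le> ennreal (12 / a * 2 ^ DIM('a)) * (\<integral>\<^sup>+x\<in>S. ennreal ((norm (D x))\<^sup>2 * exp (- \<phi> x)) \<partial>lborel)
        * (\<integral>\<^sup>+y\<in>S. ennreal (exp (- \<phi> y / 4)) \<partial>lborel)"
proof -
  have S_borel [measurable]: "S \<in> sets borel" using S(1) by simp
  have cont_\<phi>: "continuous_on S \<phi>" by (rule convex_on_continuous[OF S(1) \<phi>])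
  \<comment> \<open>Extension by zero gives Borel functions on the whole space, so that
    \<open>x\<close> and \<open>y\<close> may range over all of it when the dilation is
    applied.\<close>
  define G where "G = (\<lambda>x. ennreal (indicator S x *\<^sub>R ((norm (D x))\<^sup>2 * exp (- \<phi> x))))"
  define V where "V = (\<lambda>y. ennreal (indicator S y *\<^sub>R exp (- \<phi> y / 4)))"
  have [measurable]: "G \<in> borel_measurable borel" "V \<in> borel_measurable borel"
    unfolding G_def V_def
    by (intro measurable_compose[OF _ measurable_ennreal] borel_measurable_continuous_on_indicator continuous_intros D cont_\<phi> S_borel; simp)+
  define I where "I = (\<integral>\<^sup>+x. G x \<partial>lborel)"
  let ?z = "\<lambda>s x y. (1 - s\<^sup>2/2) *\<^sub>R x + (s\<^sup>2/2) *\<^sub>R (y::'a)"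
  let ?A = "\<lambda>x y. ennreal ((u x - u ((1/2) *\<^sub>R (x + y)))\<^sup>2 * exp (- \<phi> x) * exp (- \<phi> y))"
  have pointwise: "?A x y \<le> (\<integral>\<^sup>+s\<in>{0..1}. ennreal (12 / a) * G (?z s x y) * V y \<partial>lborel)"
    if xy: "x \<in> S" "y \<in> S" for x y
  proof -
    let ?w = "exp (- \<phi> x) * exp (- \<phi> y)"
    have "?A x y = ennreal (?w * (u x - u ((1/2) *\<^sub>R (x + y)))\<^sup>2)"
      by (simp add: mult_ac)
    also have "\<dots> \<le> (\<integral>\<^sup>+s\<in>{0..1}. ennreal (?w * (s\<^sup>2 * (norm (D (?z s x y)))\<^sup>2 * (norm (x - y))\<^sup>2)) \<partial>lborel)"
      by (intro midpoint_square_le[OF S(2) u D xy]) auto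
    also have "\<dots> \<le> (\<integral>\<^sup>+s\<in>{0..1}. ennreal (12 / a) * G (?z s x y) * V y \<partial>lborel)"
    proof (intro nn_integral_mono)
      fix s :: real
      show "ennreal (?w * (s\<^sup>2 * (norm (D (?z s x y)))\<^sup>2 * (norm (x - y))\<^sup>2)) * indicator {0..1} s
          \<le> ennreal (12 / a) * G (?z s x y) * V y * indicator {0..1} s"
      proof (cases "s \<in> {0..1}")
        case True
        then have t: "0 \<le> s\<^sup>2/2" "s\<^sup>2/2 \<le> 1/2" by (auto simp: power_le_one)
        have "?z s x y \<in> S" using t xy by (intro convexD_alt[OF S(2)]) auto
        then have GV: "ennreal (12 / a) * G (?z s x y) * V y
            = ennreal (12 / a * ((norm (D (?z s x y)))\<^sup>2 * exp (- \<phi> (?z s x y))) * exp (- \<phi> y / 4))"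
          using xy a(1) by (simp add: G_def V_def flip: ennreal_mult)
        have "?w * (s\<^sup>2 * (norm (D (?z s x y)))\<^sup>2 * (norm (x - y))\<^sup>2)
            = (norm (D (?z s x y)))\<^sup>2 * (2 * (s\<^sup>2/2) * (norm (x - y))\<^sup>2 * exp (- \<phi> x) * exp (- \<phi> y))"
          by (simp add: mult_ac)
        also have "\<dots> \<le> (norm (D (?z s x y)))\<^sup>2 * (12 / a * exp (- \<phi> (?z s x y)) * exp (- \<phi> y / 4))"
          by (intro mult_left_mono log_concave_weight_le[OF \<phi> a xy t]) auto
        finally show ?thesis
          unfolding GV using True by (simp add: ennreal_leI mult_ac)
      qed simp
    qed
    finally show ?thesis .
  qed
  \<comment> \<open>For fixed \<open>s\<close> and \<open>y\<close> the map from \<open>x\<close> to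
    \<open>?z s x y\<close> is a translated dilation of ratio \<open>1 - s\<^sup>2/2\<close>, at
    least 1/2, so the bound is uniform in \<open>s\<close> and \<open>y\<close>.\<close>
  have slice: "(\<integral>\<^sup>+x. G (?z s x y) \<partial>lborel) \<le> ennreal (2 ^ DIM('a)) * I" if "s \<in> {0..1}" for s y
  proof -
    have "s\<^sup>2 \<le> 1" using that by (simp add: power_le_one)
    then show ?thesis
      using nn_integral_dilation_le[of G "1 - s\<^sup>2/2" 2 "(s\<^sup>2/2) *\<^sub>R y"] by (simp add: I_def add.commute)
  qed
  have "(\<integral>\<^sup>+y\<in>S. (\<integral>\<^sup>+x\<in>S. ?A x y \<partial>lborel) \<partial>lborel)
      \<le> (\<integral>\<^sup>+y. (\<integral>\<^sup>+x. (\<integral>\<^sup>+s\<in>{0..1}. ennreal (12 / a) * G (?z s x y) * V y \<partial>lborel) \<partial>lborel) \<partial>lborel)"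
  proof (intro nn_integral_mono)
    fix y
    show "(\<integral>\<^sup>+x\<in>S. ?A x y \<partial>lborel) * indicator S y
        \<le> (\<integral>\<^sup>+x. (\<integral>\<^sup>+s\<in>{0..1}. ennreal (12 / a) * G (?z s x y) * V y \<partial>lborel) \<partial>lborel)"
      by (cases "y \<in> S") (auto intro!: nn_integral_mono pointwise split: split_indicator)
  qed
  \<comment> \<open>The integral over \<open>x\<close> goes innermost because the dilation acts on
    \<open>x\<close> with \<open>s\<close> and \<open>y\<close> frozen; afterwards nothing depends
    on \<open>s\<close> and the unit interval contributes 1.\<close>
  also have "\<dots> = (\<integral>\<^sup>+y. (\<integral>\<^sup>+s. (\<integral>\<^sup>+x. ennreal (12 / a) * G (?z s x y) * V y * indicator {0..1} s \<partial>lborel) \<partial>lborel) \<partial>lborel)"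
    by (intro nn_integral_cong lborel_pair.Fubini') measurable
  also have "\<dots> \<le> (\<integral>\<^sup>+y. (\<integral>\<^sup>+s\<in>{0..1::real}. ennreal (12 / a) * (ennreal (2 ^ DIM('a)) * I) * V y \<partial>lborel) \<partial>lborel)"
  proof (intro nn_integral_mono)
    fix y and s :: real
    have "(\<integral>\<^sup>+x. ennreal (12 / a) * G (?z s x y) * V y * indicator {0..1} s \<partial>lborel)
        = ennreal (12 / a) * (\<integral>\<^sup>+x. G (?z s x y) \<partial>lborel) * V y * indicator {0..1} s"
      by (simp add: nn_integral_cmult nn_integral_multc)
    also have "\<dots> \<le> ennreal (12 / a) * (ennreal (2 ^ DIM('a)) * I) * V y * indicator {0..1} s"
      by (cases "s \<in> {0..1}") (auto intro!: mult_right_mono mult_left_mono slice)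
    finally show "(\<integral>\<^sup>+x. ennreal (12 / a) * G (?z s x y) * V y * indicator {0..1} s \<partial>lborel)
        \<le> ennreal (12 / a) * (ennreal (2 ^ DIM('a)) * I) * V y * indicator {0..1} s" .
  qed
  also have "\<dots> = ennreal (12 / a * 2 ^ DIM('a)) * I * (\<integral>\<^sup>+y. V y \<partial>lborel)"
  proof -
    have "ennreal (12 / a * 2 ^ DIM('a)) = ennreal (12 / a) * ennreal (2 ^ DIM('a))"
      using a(1) by (intro ennreal_mult) auto
    then show ?thesis
      by (simp only:) (simp add: nn_integral_cmult nn_integral_cmult_indicator mult.assoc)
  qed
  also have "I = (\<integral>\<^sup>+x\<in>S. ennreal ((norm (D x))\<^sup>2 * exp (- \<phi> x)) \<partial>lborel)"
    unfolding I_def G_def by (intro nn_integral_cong) (auto split: split_indicator)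
  also have "(\<integral>\<^sup>+y. V y \<partial>lborel) = (\<integral>\<^sup>+y\<in>S. ennreal (exp (- \<phi> y / 4)) \<partial>lborel)"
    unfolding V_def by (intro nn_integral_cong) (auto split: split_indicator)
  finally show ?thesis .
qed

text \<open>Convexity and \<open>\<phi> 0 = 0\<close> give
  \<open>\<phi> ((1/4) *\<^sub>R y) \<le> \<phi> y / 4\<close>, so quartering the exponent costs
  only a dilation by 4. This brings back the mass of the original weight, which then cancels in the
  averaging.\<close>

lemma nn_integral_quarter_weight_le:
  fixes \<phi> :: "'a::euclidean_space \<Rightarrow> real"
  assumes S: "open S" "convex S" "0 \<in> S" and \<phi>: "convex_on S \<phi>" "\<phi> 0 = 0"
  shows "(\<integral>\<^sup>+y\<in>S. ennreal (exp (- \<phi> y / 4)) \<partial>lborel)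
    \<le> ennreal (4 ^ DIM('a)) * (\<integral>\<^sup>+y\<in>S. ennreal (exp (- \<phi> y)) \<partial>lborel)"
proof -
  have S_borel: "S \<in> sets borel" using S(1) by simp
  define W where "W = (\<lambda>y. ennreal (indicator S y *\<^sub>R exp (- \<phi> y)))"
  have W_eq: "W = (\<lambda>y. ennreal (exp (- \<phi> y)) * indicator S y)"
    by (auto simp: W_def fun_eq_iff split: split_indicator)
  have W_meas: "W \<in> borel_measurable borel"
    unfolding W_def
    by (intro measurable_compose[OF _ measurable_ennreal] borel_measurable_continuous_on_indicator continuous_intros
        convex_on_continuous[OF S(1) \<phi>(1)] S_borel)
  have "(\<integral>\<^sup>+y\<in>S. ennreal (exp (- \<phi> y / 4)) \<partial>lborel) \<le> (\<integral>\<^sup>+y. W (0 + (1/4) *\<^sub>R y) \<partial>lborel)"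
  proof (intro nn_integral_mono)
    fix y
    show "ennreal (exp (- \<phi> y / 4)) * indicator S y \<le> W (0 + (1/4) *\<^sub>R y)"
    proof (cases "y \<in> S")
      case True
      have "(1/4) *\<^sub>R y \<in> S" using convexD_alt[OF S(2,3) True, of "1/4"] by simp
      moreover have "\<phi> ((1/4) *\<^sub>R y) \<le> \<phi> y / 4"
        using convex_onD[OF \<phi>(1), of "1/4" 0 y] S(3) True \<phi>(2) by simp
      ultimately show ?thesis using True by (simp add: W_eq ennreal_leI)
    qed simp
  qed
  also have "\<dots> \<le> ennreal (4 ^ DIM('a)) * (\<integral>\<^sup>+y. W y \<partial>lborel)"
    by (rule nn_integral_dilation_le[OF W_meas]) auto
  finally show ?thesis by (simp add: W_eq)
qed

text \<open>With a lower bound \<open>M\<close> valid for every \<open>c\<close>, one may put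
  \<open>c = u y\<close> for each \<open>y\<close> and integrate against the weight in
  \<open>y\<close>; the mass \<open>Z\<close> then appears on both sides and cancels. In the
  constant, 48 is 4 times the 12 of the weight estimate, and \<open>8 ^ DIM('a)\<close> combines the
  dilation factors for 2 and 4.\<close>

lemma weighted_poincare:
  fixes u \<phi> :: "'a::euclidean_space \<Rightarrow> real"
  assumes S: "open S" "convex S" "bounded S" "0 \<in> S"
    and \<phi>: "convex_on S \<phi>" "\<phi> 0 = 0" and a: "0 < a" "\<And>x. x \<in> S \<Longrightarrow> a * (norm x)\<^sup>2 \<le> \<phi> x"
    and u: "\<And>x. x \<in> S \<Longrightarrow> GDERIV u x :> D x"
    and D: "continuous_on S D"
    and M: "\<And>c. M \<le> (\<integral>\<^sup>+x\<in>S. ennreal ((u x - c)\<^sup>2 * exp (- \<phi> x)) \<partial>lborel)"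
  shows "M \<le> ennreal (48 * 8 ^ DIM('a) / a) * (\<integral>\<^sup>+x\<in>S. ennreal ((norm (D x))\<^sup>2 * exp (- \<phi> x)) \<partial>lborel)"
proof -
  have S_borel [measurable]: "S \<in> sets borel" using S(1) by simp
  have cont_\<phi>: "continuous_on S \<phi>" by (rule convex_on_continuous[OF S(1) \<phi>(1)])
  have cont_u: "continuous_on S u"
    using u by (intro continuous_at_imp_continuous_on ballI) (auto simp: gderiv_def intro: has_derivative_continuous)
  define W where "W = (\<lambda>x. indicator S x *\<^sub>R exp (- \<phi> x))"
  define U where "U = (\<lambda>x. indicator S x *\<^sub>R u x)"
  have [measurable]: "W \<in> borel_measurable borel" "U \<in> borel_measurable borel"
    unfolding W_def U_def
    by (intro borel_measurable_continuous_on_indicator continuous_intros cont_u cont_\<phi> S_borel)+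
  have W_nonneg: "0 \<le> W x" for x by (simp add: W_def)
  define Z where "Z = (\<integral>\<^sup>+x. ennreal (W x) \<partial>lborel)"
  have Z_eq: "Z = (\<integral>\<^sup>+x\<in>S. ennreal (exp (- \<phi> x)) \<partial>lborel)"
    unfolding Z_def W_def by (intro nn_integral_cong) (auto split: split_indicator)
  define J where "J = (\<integral>\<^sup>+x\<in>S. ennreal ((norm (D x))\<^sup>2 * exp (- \<phi> x)) \<partial>lborel)"
  have mid: "(1/2) *\<^sub>R (x + y) \<in> S" if "x \<in> S" "y \<in> S" for x y
    using convexD_alt[OF S(2) that, of "1/2"] by (simp add: scaleR_add_right)
  \<comment> \<open>\<open>B x y\<close> compares \<open>x\<close> with the midpoint; the comparison
    of \<open>y\<close> with it is \<open>B y x\<close>, as the midpoint is symmetric.\<close>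
  define B where "B = (\<lambda>x y. ennreal ((U x - U ((1/2) *\<^sub>R (x + y)))\<^sup>2 * W x * W y))"
  have [measurable]: "(\<lambda>(x, y). B x y) \<in> borel_measurable (lborel \<Otimes>\<^sub>M lborel)"
    unfolding B_def by measurable
  have [measurable]: "(\<lambda>x. B x y) \<in> borel_measurable lborel" "(\<lambda>x. B y x) \<in> borel_measurable lborel" for y
    unfolding B_def by measurable
  have half: "(\<integral>\<^sup>+y. (\<integral>\<^sup>+x. B x y \<partial>lborel) \<partial>lborel) \<le> ennreal (12 / a * 8 ^ DIM('a)) * J * Z"
  proof -
    have "(\<integral>\<^sup>+y. (\<integral>\<^sup>+x. B x y \<partial>lborel) \<partial>lborel)
        = (\<integral>\<^sup>+y\<in>S. (\<integral>\<^sup>+x\<in>S. ennreal ((u x - u ((1/2) *\<^sub>R (x + y)))\<^sup>2 * exp (- \<phi> x) * exp (- \<phi> y)) \<partial>lborel) \<partial>lborel)"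
    proof (intro nn_integral_cong)
      fix y
      show "(\<integral>\<^sup>+x. B x y \<partial>lborel)
        = (\<integral>\<^sup>+x\<in>S. ennreal ((u x - u ((1/2) *\<^sub>R (x + y)))\<^sup>2 * exp (- \<phi> x) * exp (- \<phi> y)) \<partial>lborel) * indicator S y"
        by (cases "y \<in> S") (auto intro!: nn_integral_cong simp: B_def U_def W_def mid split: split_indicator)
    qed
    also have "\<dots> \<le> ennreal (12 / a * 2 ^ DIM('a)) * J * (\<integral>\<^sup>+y\<in>S. ennreal (exp (- \<phi> y / 4)) \<partial>lborel)"
      unfolding J_def by (rule weighted_poincare_midpoint[OF S(1,2) \<phi>(1) a u D])
    also have "\<dots> \<le> ennreal (12 / a * 2 ^ DIM('a)) * J * (ennreal (4 ^ DIM('a)) * Z)"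
      unfolding Z_eq by (intro mult_left_mono nn_integral_quarter_weight_le[OF S(1,2,4) \<phi>]) auto
    also have "\<dots> = (ennreal (12 / a * 2 ^ DIM('a)) * ennreal (4 ^ DIM('a))) * J * Z"
      by (simp only: mult_ac)
    also have "ennreal (12 / a * 2 ^ DIM('a)) * ennreal (4 ^ DIM('a)) = ennreal (12 / a * 8 ^ DIM('a))"
      using a(1) by (simp flip: ennreal_mult power_mult_distrib)
    finally show ?thesis .
  qed
  have "M * Z = (\<integral>\<^sup>+y. M * ennreal (W y) \<partial>lborel)"
    unfolding Z_def by (simp add: nn_integral_cmult)
  also have "\<dots> \<le> (\<integral>\<^sup>+y. (\<integral>\<^sup>+x. 2 * B x y + 2 * B y x \<partial>lborel) \<partial>lborel)"
  proof (rule nn_integral_mono)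
    fix y
    \<comment> \<open>The choice \<open>c = U y\<close>, which is \<open>u y\<close> on
      \<open>S\<close>; for \<open>y\<close> outside \<open>S\<close> both sides vanish with
      \<open>W y\<close>.\<close>
    have "M * ennreal (W y) \<le> (\<integral>\<^sup>+x\<in>S. ennreal ((u x - U y)\<^sup>2 * exp (- \<phi> x)) \<partial>lborel) * ennreal (W y)"
      by (intro mult_right_mono M) simp
    also have "\<dots> = (\<integral>\<^sup>+x. ennreal ((U x - U y)\<^sup>2 * W x) \<partial>lborel) * ennreal (W y)"
      by (intro arg_cong2[where f="(*)"] nn_integral_cong refl) (auto simp: U_def W_def split: split_indicator)
    also have "\<dots> = (\<integral>\<^sup>+x. ennreal ((U x - U y)\<^sup>2 * W x * W y) \<partial>lborel)"
      by (subst nn_integral_multc[symmetric]) (auto simp: W_nonneg simp flip: ennreal_mult)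
    also have "\<dots> \<le> (\<integral>\<^sup>+x. 2 * B x y + 2 * B y x \<partial>lborel)"
    proof (rule nn_integral_mono)
      fix x
      let ?m = "U ((1/2) *\<^sub>R (x + y))"
      have "(U x - U y)\<^sup>2 \<le> 2 * (U x - ?m)\<^sup>2 + 2 * (U y - ?m)\<^sup>2"
        using zero_le_power2[of "(U x - ?m) + (U y - ?m)"] by (simp add: power2_eq_square algebra_simps)
      then have "(U x - U y)\<^sup>2 * (W x * W y) \<le> (2 * (U x - ?m)\<^sup>2 + 2 * (U y - ?m)\<^sup>2) * (W x * W y)"
        by (rule mult_right_mono) (simp add: W_nonneg)
      then have "ennreal ((U x - U y)\<^sup>2 * W x * W y)
          \<le> ennreal (2 * ((U x - ?m)\<^sup>2 * W x * W y) + 2 * ((U y - ?m)\<^sup>2 * W y * W x))"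
        by (intro ennreal_leI) (simp add: algebra_simps)
      also have "\<dots> = 2 * B x y + 2 * B y x"
        by (simp add: B_def W_nonneg add.commute[of y] ennreal_plus ennreal_mult)
      finally show "ennreal ((U x - U y)\<^sup>2 * W x * W y) \<le> 2 * B x y + 2 * B y x" .
    qed
    finally show "M * ennreal (W y) \<le> (\<integral>\<^sup>+x. 2 * B x y + 2 * B y x \<partial>lborel)" .
  qed
  also have "\<dots> = 2 * (\<integral>\<^sup>+y. (\<integral>\<^sup>+x. B x y \<partial>lborel) \<partial>lborel) + 2 * (\<integral>\<^sup>+y. (\<integral>\<^sup>+x. B y x \<partial>lborel) \<partial>lborel)"
  proof -
    have "(\<integral>\<^sup>+x. 2 * B x y + 2 * B y x \<partial>lborel) = 2 * (\<integral>\<^sup>+x. B x y \<partial>lborel) + 2 * (\<integral>\<^sup>+x. B y x \<partial>lborel)" for y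
      by (subst nn_integral_add) (auto simp: nn_integral_cmult)
    moreover have "(\<lambda>y. \<integral>\<^sup>+x. B x y \<partial>lborel) \<in> borel_measurable lborel"
      "(\<lambda>y. \<integral>\<^sup>+x. B y x \<partial>lborel) \<in> borel_measurable lborel"
      unfolding B_def by measurable
    ultimately show ?thesis
      by (simp add: nn_integral_add nn_integral_cmult)
  qed
  also have "(\<integral>\<^sup>+y. (\<integral>\<^sup>+x. B y x \<partial>lborel) \<partial>lborel) = (\<integral>\<^sup>+y. (\<integral>\<^sup>+x. B x y \<partial>lborel) \<partial>lborel)"
    by (rule lborel_pair.Fubini') measurable
  also have "2 * (\<integral>\<^sup>+y. (\<integral>\<^sup>+x. B x y \<partial>lborel) \<partial>lborel) + 2 * (\<integral>\<^sup>+y. (\<integral>\<^sup>+x. B x y \<partial>lborel) \<partial>lborel)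
      \<le> 2 * (ennreal (12 / a * 8 ^ DIM('a)) * J * Z) + 2 * (ennreal (12 / a * 8 ^ DIM('a)) * J * Z)"
    by (intro add_mono mult_left_mono half) auto
  also have "\<dots> = (4 * ennreal (12 / a * 8 ^ DIM('a))) * J * Z"
    by (simp add: distrib_right[symmetric] mult.assoc[symmetric])
  also have "4 * ennreal (12 / a * 8 ^ DIM('a)) = ennreal (48 * 8 ^ DIM('a) / a)"
    using a(1) by (simp add: mult_ac flip: ennreal_numeral ennreal_mult)
  finally have MZ: "Z * M \<le> Z * (ennreal (48 * 8 ^ DIM('a) / a) * J)"
    by (simp only: mult_ac)
  \<comment> \<open>Cancelling \<open>Z\<close> among extended reals needs it positive and finite:
    \<open>S\<close> is open and nonempty, hence not null, and the weight is at most 1 on the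
    bounded set \<open>S\<close>.\<close>
  have "Z \<noteq> 0"
  proof
    assume "Z = 0"
    then have "AE x in lborel. W x \<le> 0"
      unfolding Z_def by (subst (asm) nn_integral_0_iff_AE) (auto simp: ennreal_eq_0_iff)
    then have "AE x in lborel. x \<notin> S"
      by eventually_elim (auto simp: W_def)
    then have "S \<in> null_sets lborel" by (simp add: AE_iff_null_sets)
    then show False using S(1,4) by (metis empty_iff lebesgue_openin null_sets_completionI negligible_iff_null_sets open_not_negligible)
  qed
  moreover have "Z < top"
  proof -
    have "Z \<le> (\<integral>\<^sup>+x. indicator S x \<partial>lborel)"
      unfolding Z_eq
    proof (intro nn_integral_mono)
      fix x
      have "0 \<le> \<phi> x" if "x \<in> S"
        using a(2)[OF that] a(1) by (smt (verit) mult_nonneg_nonneg zero_le_power2)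
      then show "ennreal (exp (- \<phi> x)) * indicator S x \<le> indicator S x"
        by (auto split: split_indicator)
    qed
    also have "\<dots> = emeasure lborel S" by simp
    also have "\<dots> < top" using emeasure_bounded_finite[OF S(3)] by simp
    finally show ?thesis .
  qed
  ultimately show ?thesis
    using MZ unfolding J_def by (simp add: ennreal_mult_le_mult_iff)
qed

subsection \<open>The Poincare ball\<close>

text \<open>The radial derivative of \<open>hyp_rho\<close> is \<open>2 / (1 - r\<^sup>2)\<close>,
  at least 2. This yields the quadratic growth of \<open>\<phi>\<close> with
  \<open>a = 4 / l\<^sup>2\<close>.\<close>

lemma two_norm_le_hyp_rho:
  assumes "norm x < 1"
  shows "2 * norm x \<le> hyp_rho x"
proof -
  define g where "g = (\<lambda>r::real. ln ((1 + r) / (1 - r)) - 2 * r)"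
  have "g 0 \<le> g (norm x)"
  proof (rule DERIV_nonneg_imp_nondecreasing[OF norm_ge_zero])
    fix r :: real
    assume r: "0 \<le> r" "r \<le> norm x"
    with assms have r1: "r < 1" by simp
    then have "r\<^sup>2 < 1" using r by (simp add: power_less_one_iff abs_square_less_1)
    have "(g has_real_derivative 2 / (1 - r\<^sup>2) - 2) (at r)"
      unfolding g_def using r r1 \<open>r\<^sup>2 < 1\<close>
      by (auto intro!: derivative_eq_intros simp: divide_simps power2_eq_square)
         (simp_all add: algebra_simps)
    moreover have "0 \<le> 2 / (1 - r\<^sup>2) - 2"
      using \<open>r\<^sup>2 < 1\<close> by (simp add: field_simps)
    ultimately show "\<exists>y. (g has_real_derivative y) (at r) \<and> 0 \<le> y" by blast
  qed
  then show ?thesis by (simp add: g_def hyp_rho_def)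
qed

text \<open>\<open>hyp_rho x\<close> is \<open>2 * artanh (norm x)\<close>. Hence the tanh factor of
  the theorem is a power of \<open>1 - (norm x)\<^sup>2\<close> that cancels the volume density up
  to \<open>2 ^ DIM('a)\<close>.\<close>

lemma tanh_half_hyp_rho:
  assumes "norm x < 1"
  shows "tanh (hyp_rho x / 2) = norm x"
proof -
  have "hyp_rho x / 2 = artanh (norm x)"
    by (simp add: hyp_rho_def artanh_def)
  moreover have "tanh (artanh (norm x)) = norm x"
  proof -
    have "tanh (artanh (norm x)) = (1 - exp (- 2 * artanh (norm x))) / (1 + exp (- 2 * artanh (norm x)))"
      by (rule tanh_real_altdef)
    also have "exp (- 2 * artanh (norm x)) = (1 - norm x) / (1 + norm x)"
    proof -
      have "- 2 * artanh (norm x) = ln ((1 - norm x) / (1 + norm x))"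
        using assms norm_ge_zero[of x] by (simp add: artanh_def ln_div)
      then show ?thesis using assms norm_ge_zero[of x] by (simp add: add_pos_nonneg)
    qed
    also have "(1 - (1 - norm x) / (1 + norm x)) / (1 + (1 - norm x) / (1 + norm x)) = norm x"
      using norm_ge_zero[of x] by (simp add: divide_simps add_nonneg_eq_0_iff)
    finally show ?thesis .
  qed
  ultimately show ?thesis by simp
qed

text \<open>Convexity is along Euclidean segments: a convex nondecreasing radial profile is composed
  with the norm.\<close>

lemma convex_on_hyp_rho_sq: "convex_on (ball 0 1) (\<lambda>x::'a::euclidean_space. (hyp_rho x)\<^sup>2)"
proof -
  define L where "L = (\<lambda>r::real. ln ((1 + r) / (1 - r)))"
  have L0: "0 \<le> L r" if "0 \<le> r" "r < 1" for r
    unfolding L_def using that by (intro ln_ge_zero) (simp add: field_simps)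
  have L_mono: "L r \<le> L s" if "0 \<le> r" "r \<le> s" "s < 1" for r s
    unfolding L_def using that by (subst ln_le_cancel_iff) (auto intro!: frac_le)
  have sq: "1 - s\<^sup>2 \<le> 1 - r\<^sup>2" "0 < 1 - s\<^sup>2" if "0 \<le> r" "r \<le> s" "s < 1" for r s :: real
    using that by (auto simp: power_mono abs_square_less_1)
  \<comment> \<open>The derivative \<open>4 * L r / (1 - r\<^sup>2)\<close> is nondecreasing: its
    nonnegative numerator grows while its positive denominator shrinks.\<close>
  have conv: "convex_on {0..<1} (\<lambda>r. (L r)\<^sup>2)"
  proof (rule convex_on_realI[where f' = "\<lambda>r. 4 * L r / (1 - r\<^sup>2)"])
    show "connected {0..<1::real}" by (intro convex_connected) simp
  next
    fix r :: real
    assume "r \<in> {0..<1}"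
    then have r: "0 \<le> r" "r < 1" by auto
    have "(L has_real_derivative 2 / (1 - r\<^sup>2)) (at r)"
      unfolding L_def using r sq(2)[OF r(1) order.refl r(2)]
      by (auto intro!: derivative_eq_intros simp: divide_simps power2_eq_square)
         (simp_all add: algebra_simps)
    from DERIV_power[OF this, of 2]
    show "((\<lambda>r. (L r)\<^sup>2) has_real_derivative 4 * L r / (1 - r\<^sup>2)) (at r)"
      by (simp add: mult_ac)
  next
    fix r s :: real
    assume "r \<in> {0..<1}" "s \<in> {0..<1}" "r \<le> s"
    then show "4 * L r / (1 - r\<^sup>2) \<le> 4 * L s / (1 - s\<^sup>2)"
      using L_mono[of r s] L0[of s] sq[of r s] by (intro frac_le) auto
  qed
  show ?thesis
  proof (rule convex_onI)
    fix t :: real and x y :: 'a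
    assume t: "0 < t" "t < 1" and xy: "x \<in> ball 0 1" "y \<in> ball 0 1"
    let ?z = "(1 - t) *\<^sub>R x + t *\<^sub>R y"
    let ?r = "(1 - t) *\<^sub>R norm x + t *\<^sub>R norm y"
    have "norm ?z \<le> ?r"
      using t norm_triangle_ineq[of "(1 - t) *\<^sub>R x" "t *\<^sub>R y"] by simp
    moreover have "?r \<in> {0..<1}"
      using t xy convexD_alt[of "{0..<1::real}" "norm x" "norm y" t] by simp
    ultimately have "(L (norm ?z))\<^sup>2 \<le> (L ?r)\<^sup>2"
      by (intro power_mono L_mono L0) auto
    also have "\<dots> \<le> (1 - t) * (L (norm x))\<^sup>2 + t * (L (norm y))\<^sup>2"
      using t xy by (intro convex_onD[OF conv]) auto
    finally show "(hyp_rho ?z)\<^sup>2 \<le> (1 - t) * (hyp_rho x)\<^sup>2 + t * (hyp_rho y)\<^sup>2"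
      by (simp add: L_def hyp_rho_def)
  qed simp
qed

section \<open>Gradients of test functions\<close>

lemma GDERIV_gradient:
  assumes "u differentiable (at x)"
  shows "gradient u x = (\<Sum>b\<in>Basis. frechet_derivative u (at x) b *\<^sub>R b)"
    and "GDERIV u x :> gradient u x"
proof -
  let ?F = "frechet_derivative u (at x)"
  let ?D = "\<Sum>b\<in>Basis. ?F b *\<^sub>R b"
  have F: "(u has_derivative ?F) (at x)"
    using assms by (simp add: frechet_derivative_works)
  interpret F: bounded_linear ?F by (rule has_derivative_bounded_linear[OF F])
  \<comment> \<open>Riesz representation in coordinates. The explicit sum also passes continuity of
    directional derivatives on to the gradient.\<close>
  have "?F = (\<lambda>h. h \<bullet> ?D)"
  proof
    fix h
    have "?F h = ?F (\<Sum>b\<in>Basis. (h \<bullet> b) *\<^sub>R b)" by (simp add: euclidean_representation)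
    also have "\<dots> = h \<bullet> ?D" by (simp add: F.sum F.scaleR inner_sum_right mult.commute)
    finally show "?F h = h \<bullet> ?D" .
  qed
  then have G: "GDERIV u x :> ?D" unfolding gderiv_def by (rule has_derivative_eq_rhs[OF F])
  \<comment> \<open>Uniqueness makes the definite description in \<open>gradient\<close> denote
    \<open>?D\<close>.\<close>
  have "D' = ?D" if "GDERIV u x :> D'" for D'
  proof -
    have "(\<lambda>h. h \<bullet> D') = (\<lambda>h. h \<bullet> ?D)"
      using has_derivative_unique that G by (auto simp: gderiv_def)
    then show ?thesis using vector_eq_ldot[of D' ?D] by (simp only: fun_eq_iff)
  qed
  with G show "gradient u x = ?D" unfolding gradient_def by (intro the_equality)
  with G show "GDERIV u x :> gradient u x" by simp
qed

lemma test_function_gradient: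
  fixes u :: "'a::euclidean_space \<Rightarrow> real"
  assumes "u \<in> test_functions"
  shows "continuous_on (ball 0 1) u"
    and "\<And>x. x \<in> ball 0 1 \<Longrightarrow> GDERIV u x :> gradient u x"
    and "continuous_on (ball 0 1) (gradient u)"
    and "\<And>x. x \<in> ball 0 1 - closure (support_on (ball 0 1) u) \<Longrightarrow> gradient u x = 0"
proof -
  let ?B = "ball 0 1 :: 'a set"
  have C1: "times_diff_on (Suc 0) ?B u" and C0: "times_diff_on 0 ?B u"
    using assms unfolding test_functions_def smooth_on_def by blast+
  then show "continuous_on ?B u" by simp
  have diff: "u differentiable (at x)" if "x \<in> ?B" for x using C1 that by simp
  show G: "GDERIV u x :> gradient u x" if "x \<in> ?B" for x by (rule GDERIV_gradient(2)[OF diff[OF that]])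
  have "continuous_on ?B (\<lambda>x. \<Sum>b\<in>Basis. frechet_derivative u (at x) b *\<^sub>R b)"
    using C1 by (intro continuous_intros) simp
  then show "continuous_on ?B (gradient u)"
    by (rule continuous_on_eq) (simp add: GDERIV_gradient(1)[OF diff])
  show "gradient u x = 0" if x: "x \<in> ?B - closure (support_on ?B u)" for x
  proof -
    \<comment> \<open>On this open set \<open>u\<close> is identically 0, so its derivative is that
      of a constant; this later confines the energy to a compact set.\<close>
    let ?O = "?B - closure (support_on ?B u)"
    have "open ?O" by auto
    have zero: "u y = 0" if "y \<in> ?O" for y
      using that closure_subset[of "support_on ?B u"] by (auto simp: support_on_def)
    have "((\<lambda>_. 0) has_derivative (\<lambda>h. h \<bullet> gradient u x)) (at x)"
      by (rule has_derivative_transform_within_open[where f = u, OF _ \<open>open ?O\<close> x])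
         (use G x zero in \<open>auto simp: gderiv_def\<close>)
    then have "(\<lambda>h. h \<bullet> gradient u x) = (\<lambda>_. 0)"
      by (rule has_derivative_unique) simp
    then show ?thesis by (metis inner_eq_zero_iff)
  qed
qed

section \<open>Integration against the hyperbolic volume\<close>

lemma continuous_on_hyp_rho: "continuous_on (ball (0::'a::euclidean_space) 1) hyp_rho"
proof -
  have "1 + norm x \<noteq> 0" for x :: 'a using norm_ge_zero[of x] by linarith
  then show ?thesis unfolding hyp_rho_def by (intro continuous_intros) auto
qed

text \<open>Continuity serves measurability on the ball. No integrability is assumed: where it
  fails, both Bochner integrals take the default value 0.\<close>

lemma integral_hyp_volume:
  fixes f :: "'a::euclidean_space \<Rightarrow> real"
  assumes f: "continuous_on (ball 0 1) f"
  shows "(LINT x|hyp_volume. f x)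
    = (LINT x|lborel. indicator (ball 0 1) x *\<^sub>R ((2 / (1 - (norm x)\<^sup>2)) ^ DIM('a) * f x))"
proof -
  have [measurable]: "f \<in> borel_measurable (restrict_space lborel (ball 0 1))"
  proof -
    have "sets (restrict_space lborel (ball 0 1)) = sets (restrict_space (borel :: 'a measure) (ball 0 1))"
      by (simp add: sets_restrict_space)
    then show ?thesis
      using borel_measurable_continuous_on_restrict[OF f] measurable_cong_sets by blast
  qed
  have [measurable]: "(\<lambda>x :: 'a. (2 / (1 - (norm x)\<^sup>2)) ^ DIM('a)) \<in> borel_measurable (restrict_space lborel (ball 0 1))"
    by (rule measurable_restrict_space1) measurable
  have "AE x :: 'a in restrict_space lborel (ball 0 1). 0 \<le> (2 / (1 - (norm x)\<^sup>2)) ^ DIM('a)"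
    by (rule AE_I2) (auto simp: space_restrict_space abs_square_le_1)
  then show ?thesis
    unfolding hyp_volume_def by (subst integral_density) (auto simp: integral_restrict_space)
qed

text \<open>Without integrability the left side is the default 0, so the real integrals under the
  infimum can be compared with extended ones for every \<open>c\<close>.\<close>

lemma ennreal_integral_le_nn_integral:
  assumes "\<And>x. 0 \<le> f x"
  shows "ennreal (integral\<^sup>L M f) \<le> (\<integral>\<^sup>+x. ennreal (f x) \<partial>M)"
  by (cases "integrable M f") (auto simp: nn_integral_eq_integral assms not_integrable_integral_eq)

section \<open>Reduction of the hyperbolic inequality to the weighted Euclidean one\<close>

theorem theorem1p4:
  assumes "DIM('a::euclidean_space) \<ge> 2"
  shows "\<exists>K::real. K > 0 \<and>
    (\<forall>u \<in> (test_functions :: ('a \<Rightarrow> real) set). \<forall>l::real. l > 0 \<longrightarrow>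
      l\<^sup>2 / 2 * (LINT x|hyp_volume.
          (hyp_norm x (hyp_gradient u x))\<^sup>2 * exp (- ((hyp_rho x)\<^sup>2 / l\<^sup>2)))
      \<ge> K * (INF c::real. LINT x|hyp_volume.
          \<bar>u x - c\<bar>\<^sup>2 * (1 - (tanh (hyp_rho x / 2))\<^sup>2) ^ DIM('a)
            * exp (- ((hyp_rho x)\<^sup>2 / l\<^sup>2))))"
proof (intro exI conjI ballI allI impI)
  \<comment> \<open>\<open>weighted_poincare\<close> with \<open>a = 4 / l\<^sup>2\<close> gives
    \<open>12 * 8 ^ DIM('a) * l\<^sup>2\<close>; the factor \<open>2 ^ DIM('a)\<close> from
    \<open>R_eq\<close> turns 8 into 16, and writing \<open>l\<^sup>2\<close> as twice
    \<open>l\<^sup>2 / 2\<close> turns 12 into 24.\<close>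
  show "0 < 1 / (24 * 16 ^ DIM('a) :: real)" by simp
next
  fix u :: "'a \<Rightarrow> real" and l :: real
  assume u: "u \<in> test_functions" and l: "0 < l"
  let ?B = "ball 0 1 :: 'a set" and ?N = "DIM('a)"
  define \<phi> where "\<phi> = (\<lambda>x::'a. (hyp_rho x)\<^sup>2 / l\<^sup>2)"
  define q where "q = (\<lambda>x::'a. 2 / (1 - (norm x)\<^sup>2))"
  define K where "K = closure (support_on ?B u)"
  note Du = test_function_gradient[OF u]
  have K: "compact K" "K \<subseteq> ?B" using u by (auto simp: K_def test_functions_def)
  have pos: "0 < 1 - (norm x)\<^sup>2" if "x \<in> ?B" for x
    using that by (simp add: abs_square_less_1)
  have q: "1 \<le> q x" if "x \<in> ?B" for x
    using pos[OF that] by (simp add: q_def field_simps)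
  have cont_q: "continuous_on ?B q"
    unfolding q_def using pos by (intro continuous_intros) force
  have cont_\<phi>: "continuous_on ?B \<phi>"
    unfolding \<phi>_def using l by (intro continuous_intros continuous_on_hyp_rho) auto
  have cont_inv: "continuous_on ?B (\<lambda>x. (norm (gradient u x))\<^sup>2 / (q x)\<^sup>2 * exp (- \<phi> x))"
    using q by (intro continuous_intros Du(3) cont_q cont_\<phi>) force

  \<comment> \<open>The metric contributes \<open>(q x)\<^sup>2\<close>, while each of the two
    gradients carries a factor \<open>(1 / q x)\<^sup>2\<close>.\<close>
  have energy: "(hyp_norm x (hyp_gradient u x))\<^sup>2 = (norm (gradient u x))\<^sup>2 / (q x)\<^sup>2" if "x \<in> ?B" for x
  proof -
    have "hyp_gradient u x = (1 / q x)\<^sup>2 *\<^sub>R gradient u x" by (simp add: hyp_gradient_def q_def)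
    then have "(hyp_norm x (hyp_gradient u x))\<^sup>2
        = (q x)\<^sup>2 * ((1 / q x)\<^sup>2 * ((1 / q x)\<^sup>2 * (norm (gradient u x))\<^sup>2))"
      by (simp add: hyp_norm_def hyp_inner_def q_def power2_norm_eq_inner)
    also have "\<dots> = (norm (gradient u x))\<^sup>2 / (q x)\<^sup>2"
      using q[OF that] by (simp add: field_simps power2_eq_square)
    finally show ?thesis .
  qed

  let ?L = "LINT x|hyp_volume. (hyp_norm x (hyp_gradient u x))\<^sup>2 * exp (- ((hyp_rho x)\<^sup>2 / l\<^sup>2))"
  let ?h = "\<lambda>x. (q x) ^ ?N * ((norm (gradient u x))\<^sup>2 / (q x)\<^sup>2 * exp (- \<phi> x))"
  have L_eq: "?L = (LINT x|lborel. indicator ?B x *\<^sub>R ?h x)"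
  proof -
    have "continuous_on ?B (\<lambda>x. (hyp_norm x (hyp_gradient u x))\<^sup>2 * exp (- ((hyp_rho x)\<^sup>2 / l\<^sup>2)))"
      by (rule continuous_on_eq[OF cont_inv]) (simp add: energy \<phi>_def)
    moreover have "indicator ?B x *\<^sub>R ((2 / (1 - (norm x)\<^sup>2)) ^ ?N
          * ((hyp_norm x (hyp_gradient u x))\<^sup>2 * exp (- ((hyp_rho x)\<^sup>2 / l\<^sup>2))))
        = indicator ?B x *\<^sub>R ?h x" for x
      by (cases "x \<in> ?B") (simp_all only: energy, simp_all add: q_def \<phi>_def)
    ultimately show ?thesis by (simp only: integral_hyp_volume)
  qed
  have J_le: "(\<integral>\<^sup>+x\<in>?B. ennreal ((norm (gradient u x))\<^sup>2 * exp (- \<phi> x)) \<partial>lborel) \<le> ennreal ?L"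
  proof -
    have "(\<integral>\<^sup>+x\<in>?B. ennreal ((norm (gradient u x))\<^sup>2 * exp (- \<phi> x)) \<partial>lborel)
        \<le> (\<integral>\<^sup>+x. ennreal (indicator ?B x *\<^sub>R ?h x) \<partial>lborel)"
    proof (intro nn_integral_mono)
      fix x
      show "ennreal ((norm (gradient u x))\<^sup>2 * exp (- \<phi> x)) * indicator ?B x
          \<le> ennreal (indicator ?B x *\<^sub>R ?h x)"
      proof (cases "x \<in> ?B")
        case True
        \<comment> \<open>Here the dimension bound enters: the volume density outweighs the
          \<open>(q x)\<^sup>2\<close> in the denominator, leaving a power of \<open>q x\<close>
          that is at least 1.\<close>
        have "(q x) ^ ?N = (q x)\<^sup>2 * (q x) ^ (?N - 2)"
          by (metis assms le_add_diff_inverse power_add)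
        then have "?h x = (q x) ^ (?N - 2) * ((norm (gradient u x))\<^sup>2 * exp (- \<phi> x))"
          using q[OF True] by (simp add: field_simps)
        moreover have "1 * ((norm (gradient u x))\<^sup>2 * exp (- \<phi> x)) \<le> (q x) ^ (?N - 2) * ((norm (gradient u x))\<^sup>2 * exp (- \<phi> x))"
          using q[OF True] by (intro mult_right_mono one_le_power) auto
        ultimately show ?thesis using True by (simp add: ennreal_leI)
      qed simp
    qed
    also have "\<dots> = ennreal ?L"
      unfolding L_eq
    proof (rule nn_integral_eq_integral)
      \<comment> \<open>Integrability is essential, since otherwise \<open>?L\<close> would be 0 by
        default. The density blows up at the boundary, but the gradient vanishes off the compact set
        \<open>K\<close> inside the ball.\<close>
      have "integrable lborel (\<lambda>x. indicator K x *\<^sub>R ?h x)"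
        by (intro borel_integrable_compact K continuous_on_mult continuous_on_power
            continuous_on_subset[OF cont_q K(2)] continuous_on_subset[OF cont_inv K(2)])
      moreover have "indicator K x *\<^sub>R ?h x = indicator ?B x *\<^sub>R ?h x" for x
        using Du(4)[of x] K(2) by (auto simp: K_def split: split_indicator)
      ultimately show "integrable lborel (\<lambda>x. indicator ?B x *\<^sub>R ?h x)" by (simp only:)
      show "AE x in lborel. 0 \<le> indicator ?B x *\<^sub>R ?h x"
        using q by (intro AE_I2) (force split: split_indicator)
    qed
    finally show ?thesis .
  qed

  let ?R = "\<lambda>c. LINT x|hyp_volume. \<bar>u x - c\<bar>\<^sup>2 * (1 - (tanh (hyp_rho x / 2))\<^sup>2) ^ ?N
            * exp (- ((hyp_rho x)\<^sup>2 / l\<^sup>2))"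
  have R_eq: "?R c = 2 ^ ?N * (LINT x|lborel. indicator ?B x *\<^sub>R ((u x - c)\<^sup>2 * exp (- \<phi> x)))" for c
  proof -
    have "continuous_on ?B (\<lambda>x. (u x - c)\<^sup>2 * (1 - (norm x)\<^sup>2) ^ ?N * exp (- \<phi> x))"
      by (intro continuous_intros Du(1) cont_\<phi>)
    then have "continuous_on ?B (\<lambda>x. \<bar>u x - c\<bar>\<^sup>2 * (1 - (tanh (hyp_rho x / 2))\<^sup>2) ^ ?N * exp (- ((hyp_rho x)\<^sup>2 / l\<^sup>2)))"
      by (rule continuous_on_eq) (simp add: tanh_half_hyp_rho \<phi>_def)
    from integral_hyp_volume[OF this]
    have "?R c = (LINT x|lborel. indicator ?B x *\<^sub>R ((2 / (1 - (norm x)\<^sup>2)) ^ ?N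
        * (\<bar>u x - c\<bar>\<^sup>2 * (1 - (tanh (hyp_rho x / 2))\<^sup>2) ^ ?N * exp (- ((hyp_rho x)\<^sup>2 / l\<^sup>2)))))" .
    also have "\<dots> = (LINT x|lborel. 2 ^ ?N * (indicator ?B x *\<^sub>R ((u x - c)\<^sup>2 * exp (- \<phi> x))))"
    proof (intro Bochner_Integration.integral_cong refl)
      fix x :: 'a
      have "(2 / (1 - (norm x)\<^sup>2)) ^ ?N * (\<bar>u x - c\<bar>\<^sup>2 * (1 - (tanh (hyp_rho x / 2))\<^sup>2) ^ ?N * exp (- ((hyp_rho x)\<^sup>2 / l\<^sup>2)))
          = 2 ^ ?N * ((u x - c)\<^sup>2 * exp (- \<phi> x))" if "x \<in> ?B"
        using that pos[OF that] by (simp add: tanh_half_hyp_rho \<phi>_def power_divide)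
      then show "indicator ?B x *\<^sub>R ((2 / (1 - (norm x)\<^sup>2)) ^ ?N
          * (\<bar>u x - c\<bar>\<^sup>2 * (1 - (tanh (hyp_rho x / 2))\<^sup>2) ^ ?N * exp (- ((hyp_rho x)\<^sup>2 / l\<^sup>2))))
        = 2 ^ ?N * (indicator ?B x *\<^sub>R ((u x - c)\<^sup>2 * exp (- \<phi> x)))"
        by (auto split: split_indicator)
    qed
    finally show ?thesis by simp
  qed
  have INF_le: "ennreal ((INF c. ?R c) / 2 ^ ?N) \<le> (\<integral>\<^sup>+x\<in>?B. ennreal ((u x - c)\<^sup>2 * exp (- \<phi> x)) \<partial>lborel)" for c
  proof -
    \<comment> \<open>Nonnegativity bounds the values below, so the real infimum is a genuine lower
      bound.\<close>
    have "0 \<le> ?R c" for c unfolding R_eq by (intro mult_nonneg_nonneg Bochner_Integration.integral_nonneg) auto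
    then have "(INF c. ?R c) \<le> ?R c" by (intro cINF_lower bdd_belowI[of _ 0]) auto
    then have "(INF c. ?R c) / 2 ^ ?N \<le> (LINT x|lborel. indicator ?B x *\<^sub>R ((u x - c)\<^sup>2 * exp (- \<phi> x)))"
      unfolding R_eq by (simp add: field_simps)
    then have "ennreal ((INF c. ?R c) / 2 ^ ?N) \<le> ennreal (LINT x|lborel. indicator ?B x *\<^sub>R ((u x - c)\<^sup>2 * exp (- \<phi> x)))"
      by (rule ennreal_leI)
    also have "\<dots> \<le> (\<integral>\<^sup>+x. ennreal (indicator ?B x *\<^sub>R ((u x - c)\<^sup>2 * exp (- \<phi> x))) \<partial>lborel)"
      by (rule ennreal_integral_le_nn_integral) simp
    also have "\<dots> = (\<integral>\<^sup>+x\<in>?B. ennreal ((u x - c)\<^sup>2 * exp (- \<phi> x)) \<partial>lborel)"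
      by (intro nn_integral_cong) (auto split: split_indicator)
    finally show ?thesis .
  qed

  have conv: "convex_on ?B \<phi>"
    using convex_on_cmul[OF _ convex_on_hyp_rho_sq, of "1 / l\<^sup>2"] by (simp add: \<phi>_def)
  have growth: "4 / l\<^sup>2 * (norm x)\<^sup>2 \<le> \<phi> x" if "x \<in> ?B" for x
  proof -
    have "(2 * norm x)\<^sup>2 \<le> (hyp_rho x)\<^sup>2"
      using that by (intro power_mono two_norm_le_hyp_rho) auto
    then show ?thesis using l by (simp add: \<phi>_def power_mult_distrib divide_right_mono)
  qed
  \<comment> \<open>\<open>M\<close> is the infimum divided by \<open>2 ^ ?N\<close>; the factor
    \<open>l\<^sup>2\<close> of the claim arises from \<open>1 / a\<close>.\<close>
  have "ennreal ((INF c. ?R c) / 2 ^ ?N) \<le> ennreal (48 * 8 ^ ?N / (4 / l\<^sup>2))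
      * (\<integral>\<^sup>+x\<in>?B. ennreal ((norm (gradient u x))\<^sup>2 * exp (- \<phi> x)) \<partial>lborel)"
    by (rule weighted_poincare[OF _ _ _ _ conv _ _ growth Du(2,3) INF_le])
       (use l in \<open>auto simp: \<phi>_def hyp_rho_def\<close>)
  also have "\<dots> \<le> ennreal (48 * 8 ^ ?N / (4 / l\<^sup>2)) * ennreal ?L"
    by (intro mult_left_mono J_le) simp
  also have "\<dots> = ennreal (48 * 8 ^ ?N / (4 / l\<^sup>2) * ?L)"
    by (simp add: ennreal_mult')
  finally have "(INF c. ?R c) / 2 ^ ?N \<le> 48 * 8 ^ ?N / (4 / l\<^sup>2) * ?L"
  proof (subst (asm) ennreal_le_iff)
    show "0 \<le> 48 * 8 ^ ?N / (4 / l\<^sup>2) * ?L"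
      by (intro mult_nonneg_nonneg Bochner_Integration.integral_nonneg) auto
  qed
  then have "(INF c. ?R c) \<le> 12 * (2 ^ ?N * 8 ^ ?N) * l\<^sup>2 * ?L"
    by (simp add: field_simps)
  also have "(2 ^ ?N * 8 ^ ?N :: real) = 16 ^ ?N" by (simp flip: power_mult_distrib)
  finally show "1 / (24 * 16 ^ ?N) * (INF c. ?R c) \<le> l\<^sup>2 / 2 * ?L"
    by (simp add: field_simps)
qed

end
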